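(* Let $p$ be a prime, $\alpha \in \mathbb{N}$, and let $F$ be a finite field with $q = p^{\alpha}$ elements. Let $f_1,\ldots,f_r \in F[x_1,\ldots,x_N]$, and let $A_1,\ldots,A_N$ be subgroups of the additive group $(F,+)$ with $|A_i| = p^{\alpha_i}$ for $i \in \{1,\ldots,N\}$. Assume that $$\sum_{i=1}^N \alpha_i > \alpha \sum_{j=1}^r \deg_p(f_j).$$ Then $p$ divides the cardinality of $\{\mathbf{a} \in \prod_{i=1}^N A_i \mid f_1(\mathbf{a}) = \cdots = f_r(\mathbf{a}) = 0\}$.
   Context: $\mathbb{N}$ is the set of positive integers. For a prime $p$ and $n \in \mathbb{N}_0 = \mathbb{N}\cup\{0\}$, $s_p(n)$ denotes the digit sum of $n$ in base $p$. For a field $F$ of characteristic $p$, the $p$-weight degree of a monomial $c \prod_{i=1}^N x_i^{e_i}$ with $c \in F\setminus\{0\}$ is $\sum_{i=1}^N s_p(e_i)$. The $p$-weight degree $\deg_p(f)$ of a nonzero polynomial $f \in F[x_1,\ldots,x_N]$ is the maximum of the $p$-weight degrees of its monomials, and $\deg_p(0) := 0$. *)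

theory Defs
  imports "HOL-Library.Poly_Mapping" "HOL-Library.FuncSet" "HOL-Library.Cardinality"
    "HOL-Computational_Algebra.Primes" "HOL-Algebra.Group"
begin

text \<open>A polynomial in variables \<open>x\<^sub>i\<close> (\<open>i :: nat\<close>) is a finitely supported map from exponent
  vectors to coefficients; \<open>lookup m i\<close> is the exponent of \<open>x\<^sub>i\<close> in the monomial \<open>m\<close>. The ring
  operations from \<open>HOL-Library.Poly_Mapping\<close> make this the polynomial ring.\<close>

type_synonym 'a mpoly = "(nat \<Rightarrow>\<^sub>0 nat) \<Rightarrow>\<^sub>0 'a"

definition mpoly_ring :: "nat \<Rightarrow> 'a::zero mpoly set" where
  "mpoly_ring N = {f. \<forall>m \<in> Poly_Mapping.keys f. Poly_Mapping.keys m \<subseteq> {1..N}}"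

definition eval_mpoly :: "(nat \<Rightarrow> 'a) \<Rightarrow> 'a::comm_semiring_1 mpoly \<Rightarrow> 'a" where
  "eval_mpoly a f = (\<Sum>m \<in> Poly_Mapping.keys f.
    Poly_Mapping.lookup f m * (\<Prod>i \<in> Poly_Mapping.keys m. a i ^ Poly_Mapping.lookup m i))"

text \<open>The guard \<open>b < 2\<close> only secures termination; bases are meant to be at least 2.\<close>

fun digit_sum :: "nat \<Rightarrow> nat \<Rightarrow> nat" where
  "digit_sum b n = (if n = 0 \<or> b < 2 then 0 else n mod b + digit_sum b (n div b))"

declare digit_sum.simps [simp del]

definition weight_monom :: "nat \<Rightarrow> (nat \<Rightarrow>\<^sub>0 nat) \<Rightarrow> nat" where
  "weight_monom p m = (\<Sum>i \<in> Poly_Mapping.keys m. digit_sum p (Poly_Mapping.lookup m i))"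

definition weight_degree :: "nat \<Rightarrow> 'a::zero mpoly \<Rightarrow> nat" where
  "weight_degree p f = (if f = 0 then 0 else Max (weight_monom p ` Poly_Mapping.keys f))"

definition additive_group :: "'a::ab_group_add monoid" where
  "additive_group = \<lparr>carrier = UNIV, monoid.mult = (+), one = 0\<rparr>"

lemma comm_group_additive_group: "comm_group (additive_group :: 'a::ab_group_add monoid)"
  by (rule comm_groupI) (auto simp: additive_group_def ac_simps intro: exI[of _ "- _"])

lemma subgroup_additive_group_iff:
  "subgroup H (additive_group :: 'a::ab_group_add monoid) \<longleftrightarrow>
    0 \<in> H \<and> (\<forall>x\<in>H. \<forall>y\<in>H. x + y \<in> H) \<and> (\<forall>x\<in>H. - x \<in> H)"
proof -
  interpret comm_group "additive_group :: 'a monoid" by (rule comm_group_additive_group)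
  have "inv\<^bsub>additive_group\<^esub> x = - x" for x :: 'a
    by (rule inv_equality) (simp_all add: additive_group_def)
  then show ?thesis
    by (auto simp: subgroup_def) (auto simp: additive_group_def)
qed

end

theory Submission
  imports Defs
begin

text \<open>The indicator function of the zero set is the product of the \<open>1 - f\<^sub>j ^ (q - 1)\<close>, so it suffices
  that this product sums to \<open>0\<close> in the field. Since \<open>x ^ p ^ k\<close> is additive in \<open>x\<close>, a monomial of
  \<open>p\<close>-weight degree \<open>d\<close> is a product of \<open>d\<close> additive functions. Frobenius powers preserve this \<open>d\<close>
  and \<open>q - 1\<close> has digit sum \<open>\<alpha> (p - 1)\<close>, so the indicator is a combination of products of at most
  \<open>\<alpha> (p - 1) \<Sum>\<^sub>j deg\<^sub>p f\<^sub>j < (p - 1) \<Sum>\<^sub>i \<alpha>\<^sub>i\<close> additive functions of single variables. In each of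
  them some variable \<open>x\<^sub>i\<close> occurs in fewer than \<open>(p - 1) \<alpha>\<^sub>i\<close> factors, and the sum of such a product
  over \<open>A\<^sub>i\<close> vanishes.\<close>

section \<open>Finite fields: the characteristic and the exponent \<open>q - 1\<close>\<close>

text \<open>Translation by 1 permutes the ring, so summing \<open>x + 1\<close> and summing
  \<open>x\<close> give the same value.\<close>

lemma of_nat_CARD_eq_0: "of_nat CARD('a) = (0 :: 'a::{ring_1,finite})"
proof -
  have "(\<Sum>x\<in>UNIV. x + 1) = (\<Sum>x\<in>UNIV. x :: 'a)"
    by (rule sum.reindex_bij_witness[of _ "\<lambda>x. x - 1" "\<lambda>x. x + 1"]) auto
  then show ?thesis by (simp add: sum.distrib)
qed

text \<open>Multiplication by \<open>x\<close> permutes the nonzero elements; their product is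
  nonzero and cancels.\<close>

lemma power_CARD_minus_1:
  fixes x :: "'a::{field,finite}"
  assumes "x \<noteq> 0"
  shows "x ^ (CARD('a) - 1) = 1"
proof -
  have "(\<Prod>y\<in>UNIV - {0}. x * y) = (\<Prod>y\<in>UNIV - {0}. y)"
    by (rule prod.reindex_bij_witness[of _ "\<lambda>y. y / x" "\<lambda>y. x * y"]) (use assms in auto)
  then have "x ^ (CARD('a) - 1) * (\<Prod>y\<in>UNIV - {0}. y) = 1 * (\<Prod>y\<in>UNIV - {0}. y)"
    by (simp add: prod.distrib card_Diff_singleton)
  moreover have "(\<Prod>y\<in>UNIV - {0}. y :: 'a) \<noteq> 0"
    by simp
  ultimately show ?thesis
    using mult_right_cancel by blast
qed

lemma CHAR_eq_prime_of_CARD: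
  assumes "prime p" "CARD('a::{field,finite}) = p ^ n"
  shows "CHAR('a) = p"
proof -
  have "(of_nat p :: 'a) ^ n = 0"
    using of_nat_CARD_eq_0[where 'a = 'a] assms(2) by simp
  then have "of_nat p = (0 :: 'a)"
    by simp
  then have "CHAR('a) dvd p"
    by (simp add: of_nat_eq_0_iff_char_dvd)
  then show ?thesis
    using assms(1) CHAR_not_1'[where 'a = 'a] by (auto simp: prime_nat_iff)
qed

section \<open>Power sums and products of additive functions\<close>

text \<open>Telescoping \<open>(c + 1) ^ (k + 1) - c ^ (k + 1)\<close> over \<open>c < p\<close> gives a recursion for the
  power sums whose leading factor \<open>k + 1\<close> is invertible.\<close>

lemma sum_of_nat_powers_CHAR:
  assumes "k < CHAR('a::idom) - 1"
  shows "(\<Sum>c<CHAR('a). (of_nat c :: 'a) ^ k) = 0"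
  using assms
proof (induction k rule: less_induct)
  case (less k)
  let ?S = "\<lambda>i. \<Sum>c<CHAR('a). (of_nat c :: 'a) ^ i"
  \<comment> \<open>Both ends of the telescope vanish: \<open>of_nat CHAR('a)\<close> is 0, and the
    exponent \<open>Suc k\<close> is positive.\<close>
  have "0 = (\<Sum>c<CHAR('a). (of_nat (Suc c) :: 'a) ^ Suc k - of_nat c ^ Suc k)"
    by (subst sum_lessThan_telescope) simp
  also have "\<dots> = (\<Sum>c<CHAR('a). \<Sum>i\<le>k. of_nat (Suc k choose i) * (of_nat c :: 'a) ^ i)"
  proof (intro sum.cong refl)
    fix c
    have "(of_nat (Suc c) :: 'a) ^ Suc k = (\<Sum>i\<le>Suc k. of_nat (Suc k choose i) * of_nat c ^ i)"
      using binomial_ring[of "of_nat c :: 'a" 1 "Suc k"] by (simp add: add.commute)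
    then show "(of_nat (Suc c) :: 'a) ^ Suc k - of_nat c ^ Suc k
        = (\<Sum>i\<le>k. of_nat (Suc k choose i) * of_nat c ^ i)"
      by simp
  qed
  also have "\<dots> = (\<Sum>i\<le>k. of_nat (Suc k choose i) * ?S i)"
    by (subst sum.swap) (simp add: sum_distrib_left)
  also have "\<dots> = (\<Sum>i<Suc k. of_nat (Suc k choose i) * ?S i)"
    by (simp add: lessThan_Suc_atMost)
  \<comment> \<open>By the induction hypothesis only the term \<open>i = k\<close> survives.\<close>
  also have "\<dots> = of_nat (Suc k) * ?S k"
    using less by (simp add: binomial_Suc_n)
  finally have "of_nat (Suc k) * ?S k = 0" ..
  moreover have "of_nat (Suc k) \<noteq> (0 :: 'a)"
    unfolding of_nat_eq_0_iff_char_dvd using less.prems by (auto dest: dvd_imp_le)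
  ultimately show ?case
    by (simp only: mult_eq_0_iff) simp
qed

lemma additive_of_nat_mult:
  fixes L :: "'a::semiring_1_cancel \<Rightarrow> 'b::ring_1"
  assumes "\<And>x y. L (x + y) = L x + L y"
  shows "L (of_nat c * v) = of_nat c * L v"
proof -
  have "L 0 = 0" using assms[of 0 0] by simp
  then show ?thesis by (induction c) (simp_all add: assms distrib_right)
qed

text \<open>Expanding the factors \<open>L h + c * L v\<close> one by one moves them into \<open>Ms\<close> or raises
  the exponent \<open>k\<close>; in the end either the sum over \<open>c\<close> or the sum over \<open>H\<close> vanishes.\<close>

lemma sum_prod_list_translates_eq_0:
  fixes H :: "'a::idom set" and Ls Ms :: "('a \<Rightarrow> 'a) list"
  assumes H: "\<And>Ls :: ('a \<Rightarrow> 'a) list. length Ls < m \<Longrightarrow> (\<And>L x y. L \<in> set Ls \<Longrightarrow> L (x + y) = L x + L y)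
      \<Longrightarrow> (\<Sum>h\<in>H. \<Prod>L\<leftarrow>Ls. L h) = 0"
    and "length Ls + length Ms + k < m + (CHAR('a) - 1)"
    and "\<And>L x y. L \<in> set Ls \<union> set Ms \<Longrightarrow> L (x + y) = L x + L y"
  shows "(\<Sum>c<CHAR('a). \<Sum>h\<in>H. of_nat c ^ k * (\<Prod>L\<leftarrow>Ms. L h) * (\<Prod>L\<leftarrow>Ls. L h + of_nat c * L v)) = 0"
  using assms(2,3)
proof (induction Ls arbitrary: Ms k)
  case Nil
  have "(\<Sum>c<CHAR('a). \<Sum>h\<in>H. of_nat c ^ k * (\<Prod>L\<leftarrow>Ms. L h))
      = (\<Sum>c<CHAR('a). of_nat c ^ k) * (\<Sum>h\<in>H. \<Prod>L\<leftarrow>Ms. L h)"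
    by (simp add: sum_product)
  \<comment> \<open>If both failed, \<open>length Ms + k\<close> would reach the bound
    \<open>m + (CHAR('a) - 1)\<close>.\<close>
  moreover have "k < CHAR('a) - 1 \<or> length Ms < m"
    using Nil by simp linarith
  ultimately show ?case
    using sum_of_nat_powers_CHAR[where 'a = 'a, of k] H[of Ms] Nil.prems(2) by auto
next
  case (Cons L Ls)
  let ?P = "\<lambda>c h. \<Prod>L\<leftarrow>Ls. L h + of_nat c * L v"
  \<comment> \<open>Each summand has one entry fewer in \<open>Ls\<close> and one more in
    \<open>Ms\<close> or in \<open>k\<close>, so the total in the length bound is unchanged.\<close>
  have "(\<Sum>c<CHAR('a). \<Sum>h\<in>H. of_nat c ^ k * (\<Prod>L\<leftarrow>Ms. L h) * (\<Prod>L\<leftarrow>L # Ls. L h + of_nat c * L v))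
     = (\<Sum>c<CHAR('a). \<Sum>h\<in>H. of_nat c ^ k * (\<Prod>L\<leftarrow>L # Ms. L h) * ?P c h)
     + L v * (\<Sum>c<CHAR('a). \<Sum>h\<in>H. of_nat c ^ Suc k * (\<Prod>L\<leftarrow>Ms. L h) * ?P c h)"
    by (simp add: sum_distrib_left sum.distrib[symmetric] algebra_simps)
  moreover have "(\<Sum>c<CHAR('a). \<Sum>h\<in>H. of_nat c ^ k * (\<Prod>L\<leftarrow>L # Ms. L h) * ?P c h) = 0"
    using Cons.prems by (intro Cons.IH) auto
  moreover have "(\<Sum>c<CHAR('a). \<Sum>h\<in>H. of_nat c ^ Suc k * (\<Prod>L\<leftarrow>Ms. L h) * ?P c h) = 0"
    using Cons.prems by (intro Cons.IH) auto
  ultimately show ?case by simp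
qed

section \<open>Adjoining an element to a subgroup\<close>

lemma of_nat_mult_mem_subgroup:
  fixes H :: "'a::ring_1 set"
  assumes "subgroup H additive_group" "v \<in> H"
  shows "of_nat c * v \<in> H"
  using assms by (induction c) (auto simp: subgroup_additive_group_iff distrib_right)

text \<open>By Bezout \<open>d\<close> has an inverse \<open>x\<close> modulo the characteristic,
  and adding \<open>d * v\<close> to itself \<open>x\<close> times gives back
  \<open>v\<close>.\<close>

lemma of_nat_mult_mem_subgroup_cancel:
  fixes H :: "'a::idom set"
  assumes H: "subgroup H additive_group" and p: "prime CHAR('a)"
    and d: "of_nat d * v \<in> H" "\<not> CHAR('a) dvd d"
  shows "v \<in> H"
proof -
  have "coprime d CHAR('a)"
    using p d(2) by (meson coprime_commute prime_imp_coprime)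
  moreover have "CHAR('a) \<noteq> 1" by simp
  ultimately obtain x y where xy: "d * x = CHAR('a) * y + 1"
    using coprime_bezout_strong by blast
  have "of_nat x * (of_nat d * v) = (of_nat (d * x) :: 'a) * v"
    by (simp add: algebra_simps)
  also have "\<dots> = v"
    unfolding xy by simp
  finally show ?thesis
    using of_nat_mult_mem_subgroup[OF H d(1), of x] by (simp only:)
qed

text \<open>The cosets of \<open>H\<close> by the multiples \<open>c * v\<close> are disjoint. This
  gives the order of the enlarged subgroup and lets sums over it be reindexed by pairs.\<close>

lemma inj_on_adjoin_element:
  fixes H :: "'a::idom set"
  assumes H: "subgroup H additive_group" and p: "prime CHAR('a)" and v: "v \<notin> H"
  shows "inj_on (\<lambda>(c, h). h + of_nat c * v) ({..<CHAR('a)} \<times> H)"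
proof -
  have eq: "c = d" if "h \<in> H" "g \<in> H" "h + of_nat c * v = g + of_nat d * v" "c \<le> d" "d < CHAR('a)"
    for c d h g
  proof (rule ccontr)
    assume "c \<noteq> d"
    have "of_nat (d - c) * v = h - g"
      using that(3,4) by (simp add: of_nat_diff algebra_simps)
    also have "h - g \<in> H"
      using H that(1,2) unfolding subgroup_additive_group_iff by (metis diff_conv_add_uminus)
    finally have "CHAR('a) dvd d - c"
      using of_nat_mult_mem_subgroup_cancel[OF H p] v by blast
    then show False
      using that(4,5) \<open>c \<noteq> d\<close> by (auto dest!: dvd_imp_le)
  qed
  show ?thesis
  proof (rule inj_onI, clarsimp)
    fix c h d g
    assume *: "c < CHAR('a)" "h \<in> H" "d < CHAR('a)" "g \<in> H" "h + of_nat c * v = g + of_nat d * v"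
    then have "c = d"
      using eq[of h g c d] eq[of g h d c] by (metis linorder_linear)
    then show "c = d \<and> h = g" using * by simp
  qed
qed

text \<open>Coefficients of \<open>v\<close> matter only modulo the characteristic, so the range
  \<open>c < CHAR('a)\<close> already yields a closed set.\<close>

lemma subgroup_adjoin_element:
  fixes H :: "'a::idom set"
  assumes H: "subgroup H additive_group" and p: "prime CHAR('a)"
  shows "subgroup ((\<lambda>(c, h). h + of_nat c * v) ` ({..<CHAR('a)} \<times> H)) additive_group"
    (is "subgroup ?K _")
proof -
  have mem: "h + of_nat c * v \<in> ?K" if "h \<in> H" for h c
  proof -
    have "of_nat c = (of_nat (c mod CHAR('a)) :: 'a)"
      by (metis add_0 mod_div_mult_eq mult_zero_right of_nat_CHAR of_nat_add of_nat_mult add.commute)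
    then have "h + of_nat c * v = (\<lambda>(c, h). h + of_nat c * v) (c mod CHAR('a), h)"
      by simp
    then show ?thesis
      using that prime_gt_0_nat[OF p] by (intro image_eqI[where x = "(c mod CHAR('a), h)"]) auto
  qed
  have "0 \<in> ?K"
    using mem[of 0 0] H by (simp add: subgroup_additive_group_iff)
  moreover have "x + y \<in> ?K" if "x \<in> ?K" "y \<in> ?K" for x y
  proof -
    from that obtain c d h g where "h \<in> H" "g \<in> H"
      and xy: "x = h + of_nat c * v" "y = g + of_nat d * v" by auto
    then have "h + g \<in> H" using H by (simp add: subgroup_additive_group_iff)
    from mem[OF this, of "c + d"] show ?thesis
      unfolding xy by (simp add: algebra_simps)
  qed
  moreover have "- x \<in> ?K" if "x \<in> ?K" for x
  proof -
    from that obtain c h where "h \<in> H" and c: "c < CHAR('a)" and x: "x = h + of_nat c * v" by auto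
    then have "- h \<in> H" using H by (simp add: subgroup_additive_group_iff)
    \<comment> \<open>\<open>CHAR('a) - c\<close> represents \<open>- c\<close> by a natural
      number.\<close>
    from mem[OF this, of "CHAR('a) - c"] show ?thesis
      unfolding x using c by (simp add: of_nat_diff)
  qed
  ultimately show ?thesis by (simp add: subgroup_additive_group_iff)
qed

text \<open>The subgroup is built up one generator at a time; each generator contributes
  a factor \<open>p\<close> to the order and \<open>p - 1\<close> to the admissible number of factors.\<close>

lemma sum_prod_list_additive_eq_0:
  fixes A :: "'a::idom set"
  assumes A: "subgroup A additive_group" and p: "prime CHAR('a)" and card: "card A = CHAR('a) ^ n"
    and Ls: "length Ls < n * (CHAR('a) - 1)" "\<And>L x y. L \<in> set Ls \<Longrightarrow> L (x + y) = L x + L y"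
  shows "(\<Sum>x\<in>A. \<Prod>L\<leftarrow>Ls. L x) = (0 :: 'a)"
proof -
  have fin: "finite A"
    using card prime_gt_0_nat[OF p] by (intro card_ge_0_finite) simp
  have "\<exists>H \<subseteq> A. subgroup H additive_group \<and> card H = CHAR('a) ^ k \<and>
      (\<forall>Ls. length Ls < k * (CHAR('a) - 1) \<longrightarrow> (\<forall>L \<in> set Ls. \<forall>x y. L (x + y) = L x + L y)
        \<longrightarrow> (\<Sum>h\<in>H. \<Prod>L\<leftarrow>Ls. L h) = (0 :: 'a))" if "k \<le> n" for k
    using that
  proof (induction k)
    case 0
    \<comment> \<open>For the trivial subgroup the vanishing claim is void, since no list has length
      below 0.\<close>
    have "{0} \<subseteq> A" using A by (simp add: subgroup_additive_group_iff)
    then show ?case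
      by (intro exI[of _ "{0}"]) (auto simp: subgroup_additive_group_iff)
  next
    case (Suc k)
    then obtain H where HA: "H \<subseteq> A" and H: "subgroup H additive_group"
      and cH: "card H = CHAR('a) ^ k"
      and van: "\<And>Ls. length Ls < k * (CHAR('a) - 1) \<Longrightarrow> (\<And>L x y. L \<in> set Ls \<Longrightarrow> L (x + y) = L x + L y)
        \<Longrightarrow> (\<Sum>h\<in>H. \<Prod>L\<leftarrow>Ls. L h) = (0 :: 'a)"
      by auto
    have "CHAR('a) ^ k < CHAR('a) ^ n"
      using Suc.prems prime_gt_1_nat[OF p] by (intro power_strict_increasing) auto
    then have "H \<noteq> A" using cH card by auto
    then obtain v where v: "v \<in> A" "v \<notin> H" using HA by blast
    let ?f = "\<lambda>(c, h). h + of_nat c * v"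
    let ?K = "?f ` ({..<CHAR('a)} \<times> H)"
    note inj = inj_on_adjoin_element[OF H p v(2)]
    have "?K \<subseteq> A"
    proof safe
      fix c h assume "h \<in> H"
      then show "h + of_nat c * v \<in> A"
        using of_nat_mult_mem_subgroup[OF A v(1), of c] A HA
        unfolding subgroup_additive_group_iff by blast
    qed
    moreover have "card ?K = CHAR('a) ^ Suc k"
      using card_image[OF inj] by (simp add: cH card_cartesian_product)
    moreover have "(\<Sum>x\<in>?K. \<Prod>L\<leftarrow>Ls. L x) = (0 :: 'a)"
      if Ls: "length Ls < Suc k * (CHAR('a) - 1)" "\<forall>L \<in> set Ls. \<forall>x y. L (x + y) = L x + L y" for Ls
    proof -
      have "(\<Sum>x\<in>?K. \<Prod>L\<leftarrow>Ls. L x) = (\<Sum>(c, h)\<in>{..<CHAR('a)} \<times> H. \<Prod>L\<leftarrow>Ls. L (h + of_nat c * v))"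
        by (subst sum.reindex[OF inj]) (simp add: case_prod_unfold)
      also have "\<dots> = (\<Sum>c<CHAR('a). \<Sum>h\<in>H. \<Prod>L\<leftarrow>Ls. L (h + of_nat c * v))"
        by (simp add: sum.cartesian_product)
      \<comment> \<open>The expansion starts with exponent 0 and an empty list of moved
        factors.\<close>
      also have "\<dots> = (\<Sum>c<CHAR('a). \<Sum>h\<in>H. of_nat c ^ 0 * (\<Prod>L\<leftarrow>[]. L h) * (\<Prod>L\<leftarrow>Ls. L h + of_nat c * L v))"
      proof -
        have "(\<Prod>L\<leftarrow>Ls. L (h + of_nat c * v)) = (\<Prod>L\<leftarrow>Ls. L h + of_nat c * L v)" for h c
        proof (intro arg_cong[where f = prod_list] map_cong refl)
          fix L assume "L \<in> set Ls"
          then have L: "\<And>x y. L (x + y) = L x + L y" using Ls(2) by blast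
          then show "L (h + of_nat c * v) = L h + of_nat c * L v"
            by (simp add: additive_of_nat_mult[OF L])
        qed
        then show ?thesis by simp
      qed
      also have "\<dots> = 0"
        using Ls by (intro sum_prod_list_translates_eq_0[where m = "k * (CHAR('a) - 1)"] van) auto
      finally show ?thesis .
    qed
    ultimately show ?case
      using subgroup_adjoin_element[OF H p, of v] by (intro exI[of _ ?K]) blast
  qed
  from this[of n] obtain H where H: "H \<subseteq> A" "card H = CHAR('a) ^ n"
    "\<And>Ls. length Ls < n * (CHAR('a) - 1) \<Longrightarrow> (\<And>L x y. L \<in> set Ls \<Longrightarrow> L (x + y) = L x + L y)
        \<Longrightarrow> (\<Sum>h\<in>H. \<Prod>L\<leftarrow>Ls. L h) = (0 :: 'a)"
    by auto
  then have "H = A" using card fin by (simp add: card_subset_eq)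
  then show ?thesis using H(3) Ls by blast
qed

section \<open>The span of products of Frobenius powers\<close>

text \<open>A list of pairs allows repetitions, so its length counts factors with
  multiplicity.\<close>

abbreviation frob_monom :: "(nat \<times> nat) list \<Rightarrow> (nat \<Rightarrow> 'a::comm_ring_1) \<Rightarrow> 'a" where
  "frob_monom ks a \<equiv> (\<Prod>(i, k)\<leftarrow>ks. a i ^ CHAR('a) ^ k)"

text \<open>The span of the products of at most \<open>n\<close> factors \<open>a i ^ p ^ k\<close>, \<open>i \<in> I\<close>. For the indicator
  argument it replaces the polynomials of \<open>p\<close>-weight degree at most \<open>n\<close>: closure under products
  needs no carry analysis.\<close>

inductive frob_span :: "nat set \<Rightarrow> nat \<Rightarrow> ((nat \<Rightarrow> 'a::comm_ring_1) \<Rightarrow> 'a) \<Rightarrow> bool" for I n where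
  monom: "length ks \<le> n \<Longrightarrow> fst ` set ks \<subseteq> I \<Longrightarrow> frob_span I n (\<lambda>a. c * frob_monom ks a)"
| add: "frob_span I n F \<Longrightarrow> frob_span I n G \<Longrightarrow> frob_span I n (\<lambda>a. F a + G a)"

lemma frob_span_const: "frob_span I n (\<lambda>a. c)"
  using frob_span.monom[of "[]" n I c] by simp

lemma frob_span_mono: "frob_span I m F \<Longrightarrow> m \<le> n \<Longrightarrow> frob_span I n F"
  by (induction rule: frob_span.induct) (auto intro: frob_span.intros)

lemma frob_span_mult:
  assumes "frob_span I m F" "frob_span I n G"
  shows "frob_span I (m + n) (\<lambda>a. F a * G a)"
  using assms
proof (induction rule: frob_span.induct)
  case (monom ks c)
  note ks = monom.hyps
  from monom.prems show ?case
  proof (induction rule: frob_span.induct)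
    case (monom ls d)
    have "frob_span I (m + n) (\<lambda>a. (c * d) * frob_monom (ks @ ls) a)"
      using ks monom by (intro frob_span.monom) auto
    then show ?case by (simp add: ac_simps)
  next
    case (add F G)
    then show ?case by (simp add: distrib_left frob_span.add)
  qed
next
  case (add F1 F2)
  then show ?case by (simp add: distrib_right frob_span.add)
qed

lemma frob_span_sum: "(\<And>x. x \<in> X \<Longrightarrow> frob_span I n (F x)) \<Longrightarrow> frob_span I n (\<lambda>a. \<Sum>x\<in>X. F x a)"
  by (induction X rule: infinite_finite_induct) (auto intro: frob_span_const frob_span.add)

lemma frob_span_prod:
  "(\<And>x. x \<in> X \<Longrightarrow> frob_span I (n x) (F x)) \<Longrightarrow> frob_span I (\<Sum>x\<in>X. n x) (\<lambda>a. \<Prod>x\<in>X. F x a)"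
  by (induction X rule: infinite_finite_induct) (auto intro: frob_span_const frob_span_mult)

lemma frob_span_power:
  assumes "frob_span I n F"
  shows "frob_span I (m * n) (\<lambda>a. F a ^ m)"
  by (induction m) (auto intro: frob_span_const frob_span_mult[OF assms])

text \<open>The \<open>p\<close>-th power is additive, and on a generator it only raises each
  \<open>k\<close> to \<open>Suc k\<close> and changes the coefficient; the number of factors
  stays.\<close>

lemma frob_span_Frobenius:
  fixes F :: "(nat \<Rightarrow> 'a::comm_ring_1) \<Rightarrow> 'a"
  assumes p: "prime CHAR('a)" and "frob_span I n F"
  shows "frob_span I n (\<lambda>a. F a ^ CHAR('a))"
  using assms(2)
proof (induction rule: frob_span.induct)
  case (monom ks c)
  have "frob_monom ks a ^ CHAR('a) = frob_monom (map (map_prod id Suc) ks) a" for a :: "nat \<Rightarrow> 'a"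
    by (induction ks) (auto simp: power_mult_distrib mult.commute simp flip: power_mult)
  then have eq: "(\<lambda>a. (c * frob_monom ks a) ^ CHAR('a))
      = (\<lambda>a. c ^ CHAR('a) * frob_monom (map (map_prod id Suc) ks) a)"
    by (simp add: power_mult_distrib)
  show ?case
    unfolding eq using monom by (intro frob_span.monom) (auto simp: image_image)
next
  case (add F G)
  then show ?case
    by (simp add: freshmans_dream[OF p refl] frob_span.add)
qed

lemma frob_span_power_CHAR_power:
  fixes F :: "(nat \<Rightarrow> 'a::comm_ring_1) \<Rightarrow> 'a"
  assumes p: "prime CHAR('a)" and F: "frob_span I n F"
  shows "frob_span I n (\<lambda>a. F a ^ CHAR('a) ^ k)"
proof (induction k)
  case (Suc k)
  from frob_span_Frobenius[OF p this] show ?case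
    by (simp add: mult.commute flip: power_mult)
qed (simp add: F)

text \<open>Here \<open>p ^ k - 1\<close> is expanded as the sum of the \<open>(p - 1) * p ^ j\<close>, \<open>j < k\<close>.\<close>

lemma frob_span_power_CHAR_power_minus_1:
  fixes F :: "(nat \<Rightarrow> 'a::comm_ring_1) \<Rightarrow> 'a"
  assumes p: "prime CHAR('a)" and F: "frob_span I n F"
  shows "frob_span I (k * (CHAR('a) - 1) * n) (\<lambda>a. F a ^ (CHAR('a) ^ k - 1))"
proof (induction k)
  case 0
  show ?case by (simp add: frob_span_const)
next
  case (Suc k)
  let ?p = "CHAR('a)"
  have "frob_span I (k * (?p - 1) * n + (?p - 1) * n)
      (\<lambda>a. F a ^ (?p ^ k - 1) * (F a ^ ?p ^ k) ^ (?p - 1))"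
    by (intro frob_span_mult Suc frob_span_power frob_span_power_CHAR_power p F)
  moreover have "k * (?p - 1) * n + (?p - 1) * n = Suc k * (?p - 1) * n"
    by (simp add: distrib_right)
  moreover have "(?p ^ k - 1) + ?p ^ k * (?p - 1) = ?p ^ Suc k - 1"
    using prime_gt_0_nat[OF p] by (simp add: diff_mult_distrib2 mult.commute)
  ultimately show ?case
    by (simp only: flip: power_mult power_add)
qed

section \<open>From \<open>p\<close>-weight degree to the span\<close>

text \<open>A digit \<open>c\<close> at place \<open>k\<close> is coded as \<open>c\<close> copies
  of \<open>k\<close>. In the recursion the lowest digit becomes zeros, and the places of
  \<open>n div b\<close> move up by one.\<close>

lemma digit_sum_representation:
  assumes "b \<ge> 2"
  shows "\<exists>ks. length ks = digit_sum b n \<and> (\<Sum>k\<leftarrow>ks. b ^ k) = n"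
proof (induction n rule: less_induct)
  case (less n)
  show ?case
  proof (cases "n = 0")
    case True
    then show ?thesis by (simp add: digit_sum.simps)
  next
    case False
    then have "n div b < n" using assms by simp
    from less[OF this] obtain ks where ks: "length ks = digit_sum b (n div b)" "(\<Sum>k\<leftarrow>ks. b ^ k) = n div b"
      by blast
    have "(\<Sum>k\<leftarrow>map Suc ks. b ^ k) = b * (n div b)"
      using sum_list_const_mult[of b "\<lambda>k. b ^ k" ks] ks by (simp add: o_def)
    then show ?thesis
      using ks(1) False assms
      by (intro exI[of _ "replicate (n mod b) 0 @ map Suc ks"])
        (simp add: digit_sum.simps[of b n] sum_list_replicate)
  qed
qed

lemma frob_span_variable_power:
  assumes "prime CHAR('a::comm_ring_1)" "i \<in> I"
  shows "frob_span I (digit_sum CHAR('a) e) (\<lambda>a :: nat \<Rightarrow> 'a. a i ^ e)"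
proof -
  obtain ks where ks: "length ks = digit_sum CHAR('a) e" "(\<Sum>k\<leftarrow>ks. CHAR('a) ^ k) = e"
    using digit_sum_representation[OF prime_ge_2_nat[OF assms(1)]] by blast
  have "frob_monom (map (Pair i) ks) a = a i ^ (\<Sum>k\<leftarrow>ks. CHAR('a) ^ k)" for a :: "nat \<Rightarrow> 'a"
    by (induction ks) (auto simp: power_add)
  moreover have "frob_span I (digit_sum CHAR('a) e) (\<lambda>a. 1 * frob_monom (map (Pair i) ks) a :: 'a)"
    using assms(2) ks(1) by (intro frob_span.monom) auto
  ultimately show ?thesis using ks(2) by simp
qed

lemma frob_span_eval_mpoly:
  fixes f :: "'a::comm_ring_1 mpoly"
  assumes p: "prime CHAR('a)" and f: "f \<in> mpoly_ring N"
  shows "frob_span {1..N} (weight_degree CHAR('a) f) (\<lambda>a. eval_mpoly a f)"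
  unfolding eval_mpoly_def
proof (rule frob_span_sum)
  fix m assume m: "m \<in> Poly_Mapping.keys f"
  \<comment> \<open>The summand 0 is the degree of the constant coefficient, in the shape of the
    product rule.\<close>
  have "frob_span {1..N} (0 + weight_monom CHAR('a) m)
      (\<lambda>a. Poly_Mapping.lookup f m * (\<Prod>i\<in>Poly_Mapping.keys m. a i ^ Poly_Mapping.lookup m i))"
    unfolding weight_monom_def using f m
    by (intro frob_span_mult frob_span_const frob_span_prod frob_span_variable_power p)
      (auto simp: mpoly_ring_def dest!: bspec)
  moreover have "weight_monom CHAR('a) m \<le> weight_degree CHAR('a) f"
    using m by (auto simp: weight_degree_def intro!: Max_ge)
  ultimately show "frob_span {1..N} (weight_degree CHAR('a) f)
      (\<lambda>a. Poly_Mapping.lookup f m * (\<Prod>i\<in>Poly_Mapping.keys m. a i ^ Poly_Mapping.lookup m i))"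
    by (auto intro: frob_span_mono)
qed

section \<open>Sums over the product of the subgroups\<close>

lemma prod_list_eq_prod_filter:
  fixes g :: "'b \<times> 'c \<Rightarrow> 'd::comm_monoid_mult"
  assumes "finite I" "fst ` set ks \<subseteq> I"
  shows "(\<Prod>x\<leftarrow>ks. g x) = (\<Prod>i\<in>I. \<Prod>x\<leftarrow>filter (\<lambda>x. fst x = i) ks. g x)"
  using assms(2)
proof (induction ks)
  case (Cons x ks)
  have "(\<Prod>i\<in>I. \<Prod>y\<leftarrow>filter (\<lambda>y. fst y = i) (x # ks). g y)
     = (\<Prod>i\<in>I. (if fst x = i then g x else 1) * (\<Prod>y\<leftarrow>filter (\<lambda>y. fst y = i) ks. g y))"
    by (intro prod.cong) auto
  then show ?case
    using Cons assms(1) by (simp add: prod.distrib prod.delta')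
qed simp

lemma length_eq_sum_filter:
  assumes "finite I" "fst ` set ks \<subseteq> I"
  shows "length ks = (\<Sum>i\<in>I. length (filter (\<lambda>x. fst x = i) ks))"
  using assms(2)
proof (induction ks)
  case (Cons x ks)
  have "(\<Sum>i\<in>I. length (filter (\<lambda>y. fst y = i) (x # ks)))
     = (\<Sum>i\<in>I. (if fst x = i then 1 else 0) + length (filter (\<lambda>y. fst y = i) ks))"
    by (intro sum.cong) auto
  then show ?case
    using Cons assms(1) by (simp add: sum.distrib sum.delta')
qed simp

text \<open>Grouping the factors by variable splits the sum into a product of sums over the
  \<open>A i\<close>. By pigeonhole some variable has fewer than \<open>d i * (p - 1)\<close>
  factors, and its sum is 0.\<close>

lemma sum_frob_monom_eq_0:
  fixes A :: "nat \<Rightarrow> 'a::idom set"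
  assumes I: "finite I" and p: "prime CHAR('a)"
    and A: "\<And>i. i \<in> I \<Longrightarrow> subgroup (A i) additive_group" "\<And>i. i \<in> I \<Longrightarrow> card (A i) = CHAR('a) ^ d i"
    and ks: "fst ` set ks \<subseteq> I" "length ks < (\<Sum>i\<in>I. d i) * (CHAR('a) - 1)"
  shows "(\<Sum>a\<in>PiE I A. frob_monom ks a) = 0"
proof -
  let ?ks = "\<lambda>i. filter (\<lambda>x. fst x = i) ks"
  have fin: "finite (A i)" if "i \<in> I" for i
    using A(2)[OF that] prime_gt_0_nat[OF p] by (intro card_ge_0_finite) simp
  have "frob_monom ks a = (\<Prod>i\<in>I. \<Prod>k\<leftarrow>map snd (?ks i). a i ^ CHAR('a) ^ k)" for a :: "nat \<Rightarrow> 'a"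
  proof -
    have eq: "map (\<lambda>(i, k). a i ^ CHAR('a) ^ k) (?ks i) = map (\<lambda>k. a i ^ CHAR('a) ^ k) (map snd (?ks i))" for i
      by (induction ks) auto
    show ?thesis
      using prod_list_eq_prod_filter[OF I ks(1), of "\<lambda>(i, k). a i ^ CHAR('a) ^ k"] by (simp only: eq)
  qed
  then have "(\<Sum>a\<in>PiE I A. frob_monom ks a)
      = (\<Prod>i\<in>I. \<Sum>x\<in>A i. \<Prod>k\<leftarrow>map snd (?ks i). x ^ CHAR('a) ^ k)"
    by (simp only: prod_sum_PiE[OF I fin])
  moreover have "\<exists>i\<in>I. length (?ks i) < d i * (CHAR('a) - 1)"
  proof (rule ccontr)
    assume "\<not> ?thesis"
    then have "(\<Sum>i\<in>I. d i * (CHAR('a) - 1)) \<le> length ks"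
      unfolding length_eq_sum_filter[OF I ks(1)] by (intro sum_mono) (simp add: not_less)
    then show False using ks(2) by (simp add: sum_distrib_right)
  qed
  then obtain i where i: "i \<in> I" "length (?ks i) < d i * (CHAR('a) - 1)" by blast
  \<comment> \<open>Each map from \<open>x\<close> to \<open>x ^ p ^ k\<close> is additive, so the
    vanishing result for one subgroup applies.\<close>
  have "(\<Sum>x\<in>A i. \<Prod>L\<leftarrow>map (\<lambda>k x. x ^ CHAR('a) ^ k) (map snd (?ks i)). L x) = 0"
    using i(2) by (intro sum_prod_list_additive_eq_0[OF A(1)[OF i(1)] p A(2)[OF i(1)]])
      (auto simp: freshmans_dream'[OF p refl])
  then have "(\<Sum>x\<in>A i. \<Prod>k\<leftarrow>map snd (?ks i). x ^ CHAR('a) ^ k) = 0"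
    by (simp add: o_def)
  ultimately show ?thesis using I i(1) by auto
qed

lemma sum_frob_span_eq_0:
  fixes A :: "nat \<Rightarrow> 'a::idom set"
  assumes "frob_span I n F"
    and "finite I" "prime CHAR('a)"
    and "\<And>i. i \<in> I \<Longrightarrow> subgroup (A i) additive_group" "\<And>i. i \<in> I \<Longrightarrow> card (A i) = CHAR('a) ^ d i"
    and "n < (\<Sum>i\<in>I. d i) * (CHAR('a) - 1)"
  shows "(\<Sum>a\<in>PiE I A. F a) = 0"
  using assms(1)
proof (induction rule: frob_span.induct)
  case (monom ks c)
  then have "(\<Sum>a\<in>PiE I A. frob_monom ks a) = 0"
    using assms(2-) by (intro sum_frob_monom_eq_0) auto
  then show ?case by (simp flip: sum_distrib_left)
next
  case (add F G)
  then show ?case by (simp add: sum.distrib)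
qed

section \<open>The indicator function of the zero set\<close>

theorem theorem13p2:
  fixes p \<alpha> r N :: nat
    and f :: "nat \<Rightarrow> 'a::{field,finite} mpoly"
    and A :: "nat \<Rightarrow> 'a set"
    and \<alpha>s :: "nat \<Rightarrow> nat"
  assumes "prime p"
    and "\<alpha> \<ge> 1"
    and "CARD('a) = p ^ \<alpha>"
    and "\<And>j. j \<in> {1..r} \<Longrightarrow> f j \<in> mpoly_ring N"
    and "\<And>i. i \<in> {1..N} \<Longrightarrow> subgroup (A i) additive_group"
    and "\<And>i. i \<in> {1..N} \<Longrightarrow> card (A i) = p ^ \<alpha>s i"
    and "(\<Sum>i = 1..N. \<alpha>s i) > \<alpha> * (\<Sum>j = 1..r. weight_degree p (f j))"
  shows "p dvd card {a \<in> PiE {1..N} A. \<forall>j \<in> {1..r}. eval_mpoly a (f j) = 0}"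
proof -
  have p: "CHAR('a) = p"
    using CHAR_eq_prime_of_CARD assms(1,3) by blast
  \<comment> \<open>The form \<open>1 + - 1 * y\<close> stands for \<open>1 - y\<close>, so that the
    sum and product rules of \<open>frob_span\<close> apply directly.\<close>
  define P where "P a = (\<Prod>j = 1..r. 1 + - 1 * eval_mpoly a (f j) ^ (p ^ \<alpha> - 1))" for a
  \<comment> \<open>This makes the exponent \<open>p ^ \<alpha> - 1\<close> positive, so that it
    sends 0 to 0 and not to 1.\<close>
  have "p ^ \<alpha> > 1"
    using prime_gt_1_nat[OF assms(1)] assms(2) by (intro one_less_power) auto
  then have indicator: "1 + - 1 * x ^ (p ^ \<alpha> - 1) = (if x = 0 then 1 else 0)" for x :: 'a
    using power_CARD_minus_1[of x] assms(3) by (simp add: power_0_left)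
  have P: "P a = (if \<forall>j \<in> {1..r}. eval_mpoly a (f j) = 0 then 1 else 0)" for a
    unfolding P_def indicator by (auto simp: prod_zero_iff)
  have "frob_span {1..N} (\<Sum>j = 1..r. 0 + \<alpha> * (p - 1) * weight_degree p (f j)) P"
    unfolding P_def
  proof (intro frob_span_prod frob_span.add frob_span_mult frob_span_const)
    fix j assume "j \<in> {1..r}"
    then have "frob_span {1..N} (weight_degree p (f j)) (\<lambda>a. eval_mpoly a (f j))"
      using frob_span_eval_mpoly[of "f j" N] assms(1,4) p by simp
    from frob_span_power_CHAR_power_minus_1[OF _ this, of \<alpha>]
    show "frob_span {1..N} (\<alpha> * (p - 1) * weight_degree p (f j)) (\<lambda>a. eval_mpoly a (f j) ^ (p ^ \<alpha> - 1))"
      using assms(1) p by simp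
  qed
  moreover have "(\<Sum>j = 1..r. 0 + \<alpha> * (p - 1) * weight_degree p (f j)) < (\<Sum>i = 1..N. \<alpha>s i) * (p - 1)"
  proof -
    have "(\<Sum>j = 1..r. 0 + \<alpha> * (p - 1) * weight_degree p (f j))
        = \<alpha> * (\<Sum>j = 1..r. weight_degree p (f j)) * (p - 1)"
      by (simp add: sum_distrib_left sum_distrib_right mult_ac)
    also have "\<dots> < (\<Sum>i = 1..N. \<alpha>s i) * (p - 1)"
      using assms(7) prime_gt_1_nat[OF assms(1)] by (intro mult_strict_right_mono) auto
    finally show ?thesis .
  qed
  ultimately have "(\<Sum>a\<in>PiE {1..N} A. P a) = 0"
    using assms(1,5,6) p by (intro sum_frob_span_eq_0[where d = \<alpha>s]) auto
  \<comment> \<open>The sum counts the zeros in the field, where a natural number is 0 exactly if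
    \<open>p\<close> divides it.\<close>
  moreover have "(\<Sum>a\<in>PiE {1..N} A. P a)
      = of_nat (card {a \<in> PiE {1..N} A. \<forall>j \<in> {1..r}. eval_mpoly a (f j) = 0})"
    unfolding P by (subst sum.inter_filter[symmetric]) (auto intro: finite_PiE)
  ultimately show ?thesis
    by (simp add: of_nat_eq_0_iff_char_dvd p)
qed

end
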